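(* Let $p$ be a prime and let $G$ be a finite abelian $p$-group of order $p^{n}$, with Schur multiplier of order $|M(G)|=p^{\frac{n(n-1)}{2}-t}$, and with Frattini subgroup $\Phi(G)$ of order $p^{a}$. Let $m=an-\frac{a(a+1)}{2}-t$ (so that, when $a\geq1$, $n=\frac{a(a+1)+2t+2m}{2a}$). Suppose that $\exp(G)=p^{a-m+1}$. Then $$G\cong \mathbb{Z}_{p^{a-m+1}}\oplus\mathbb{Z}_{p^{m+1}}\oplus \underbrace{\mathbb{Z}_p\oplus\cdots\oplus\mathbb{Z}_p}_{n-a-2\text{ copies}}.$$
   Context: $\mathbb{Z}_{q}$ denotes the cyclic group of order $q$. The Schur multiplier of a group $G$ with free presentation $G\cong F/R$ ($F$ free) is $M(G)=(R\cap F')/[R,F]$. $\Phi(G)$ is the Frattini subgroup of $G$, and $\exp(G)$ is the exponent of $G$.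
   Formalization: The hypothesis n − a ≥ 2 (G is not cyclic) is added: for G = Z_{p^n} with n ≥ 1 all the assumptions hold with a = n − 1 and m = 0, but the conclusion would then ask for −1 copies of Z_p. *)

theory Defs
  imports "HOL-Algebra.Algebra"
begin

text \<open>A letter is a pair (b, x): b = False means the generator x, b = True its inverse.\<close>

type_synonym 'a fword = "(bool \<times> 'a) list"

fun cons_red :: "bool \<times> 'a \<Rightarrow> 'a fword \<Rightarrow> 'a fword" where
  "cons_red x [] = [x]"
| "cons_red x (y # ys) =
     (if snd x = snd y \<and> fst x \<noteq> fst y then ys else x # y # ys)"

definition reduce_word :: "'a fword \<Rightarrow> 'a fword" where
  "reduce_word w = foldr cons_red w []"

fun reduced_word :: "'a fword \<Rightarrow> bool" where
  "reduced_word [] = True"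
| "reduced_word [x] = True"
| "reduced_word (x # y # ys) =
     (\<not> (snd x = snd y \<and> fst x \<noteq> fst y) \<and> reduced_word (y # ys))"

definition free_group :: "'a set \<Rightarrow> 'a fword monoid" where
  "free_group S = \<lparr> carrier = {w. reduced_word w \<and> snd ` set w \<subseteq> S},
                    monoid.mult = (\<lambda>u v. reduce_word (u @ v)),
                    one = [] \<rparr>"

definition eval_word :: "('g, 'b) monoid_scheme \<Rightarrow> 'g fword \<Rightarrow> 'g" where
  "eval_word G w =
     foldr (\<lambda>(b, x) acc. (if b then inv\<^bsub>G\<^esub> x else x) \<otimes>\<^bsub>G\<^esub> acc) w \<one>\<^bsub>G\<^esub>"

text \<open>We use the canonical free presentation G = F/R with F the free group on
  the carrier of G and F \<rightarrow> G the evaluation map; R is its kernel.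
  M(G) = (R \<inter> F') / [R, F].\<close>

definition hopf_R :: "('g, 'b) monoid_scheme \<Rightarrow> 'g fword set" where
  "hopf_R G = kernel (free_group (carrier G)) G (eval_word G)"

definition comm_subgroup ::
  "('a, 'b) monoid_scheme \<Rightarrow> 'a set \<Rightarrow> 'a set \<Rightarrow> 'a set" where
  "comm_subgroup F A B =
     generate F {x \<otimes>\<^bsub>F\<^esub> y \<otimes>\<^bsub>F\<^esub> inv\<^bsub>F\<^esub> x \<otimes>\<^bsub>F\<^esub> inv\<^bsub>F\<^esub> y | x y. x \<in> A \<and> y \<in> B}"

definition schur_multiplier :: "('g, 'b) monoid_scheme \<Rightarrow> 'g fword set monoid" where
  "schur_multiplier G =
     (let F = free_group (carrier G); R = hopf_R G
      in (F\<lparr>carrier := R \<inter> derived F (carrier F)\<rparr>) Mod (comm_subgroup F R (carrier F)))"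

definition maximal_subgroup :: "'a set \<Rightarrow> ('a, 'b) monoid_scheme \<Rightarrow> bool" where
  "maximal_subgroup H G \<longleftrightarrow> subgroup H G \<and> H \<noteq> carrier G \<and>
     (\<forall>K. subgroup K G \<and> H \<subseteq> K \<longrightarrow> K = H \<or> K = carrier G)"

definition frattini :: "('a, 'b) monoid_scheme \<Rightarrow> 'a set" where
  "frattini G = carrier G \<inter> \<Inter> {H. maximal_subgroup H G}"

definition group_exponent :: "('a, 'b) monoid_scheme \<Rightarrow> nat" where
  "group_exponent G = Lcm (group.ord G ` carrier G)"

end

theory Submission
  imports Defs
begin

text \<open>
  Let G have type (p^e_0, ..., p^e_(d-1)) with e_0 \<ge> e_1 \<ge> ..., and put f_j = e_j - 1. Then
  n = \<Sum> e_j, a = \<Sum> f_j and exp(G) = p^e_0. Only a lower bound for M(G) is needed: mapping the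
  free group F to integral Heisenberg groups, one for each pair i < j of coordinates of G, and
  reading off the central coordinate modulo p^e_j gives invariants on R \<inter> F' that are trivial on
  [R, F], and commutators of generators realise all their values. Hence
  |M(G)| \<ge> p^(\<Sum> j e_j), which amounts to m \<ge> \<Sum> j f_j. The assumption on the exponent says
  f_0 = a - m, i.e. m = \<Sum>_(j \<ge> 1) f_j, so that f_j = 0 for j \<ge> 2 and f_1 = m.
\<close>

section \<open>Free groups\<close>

text \<open>The Heisenberg group enters because the central coordinate of a commutator there is a 2
  by 2 determinant of exponent sums. It is bilinear, so [u, v] with u in R has determinant divisible
  by gcd(q_i, q_j), while two unit vectors give determinant 1. Once the exponents are sorted, this
  gcd is p^e_j. M(G) is given by the presentation on all elements of G, so a letter is an arbitrary
  group element and words are reduced lists. The invariants are therefore weighted sums over the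
  letters of a word, the weights being the coordinates of the letters, and they have to survive
  reduction. An upper bound for M(G) would require finding generators of R \<inter> F' modulo
  [R, F]; the lower bound only needs enough cosets to be told apart.\<close>

lemma reduced_word_Cons_iff:
  "reduced_word (x # w) \<longleftrightarrow> reduced_word w \<and> cons_red x w = x # w"
  by (cases w) auto

lemma reduced_word_cons_red: "reduced_word w \<Longrightarrow> reduced_word (cons_red x w)"
  by (cases w) (auto simp: reduced_word_Cons_iff)

lemma reduced_word_foldr: "reduced_word w \<Longrightarrow> reduced_word (foldr cons_red u w)"
  by (induction u) (auto intro: reduced_word_cons_red)

lemma reduce_word_reduced: "reduced_word w \<Longrightarrow> reduce_word w = w"
  by (induction w) (auto simp: reduce_word_def reduced_word_Cons_iff)

text \<open>Van der Waerden's device: letters act on reduced words by \<open>cons_red\<close>, and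
  opposite letters act as mutually inverse permutations. Associativity of the free group is drawn
  from this action instead of from confluence of cancellation.\<close>

lemma cons_red_cancel:
  assumes "reduced_word w" "snd x = snd y" "fst x \<noteq> fst y"
  shows "cons_red x (cons_red y w) = w"
proof (cases w)
  case (Cons z ws)
  with assms show ?thesis
    by (cases ws) (auto simp: prod_eq_iff)
qed (use assms in auto)

text \<open>If x cancels against the first letter of u, the removed pair would have acted trivially
  on w; otherwise no letter is lost. Hence reducing a word does not change its action.\<close>

lemma foldr_cons_red_cons_red:
  assumes "reduced_word w"
  shows "foldr cons_red (cons_red x u) w = cons_red x (foldr cons_red u w)"
proof (cases u)
  case (Cons y ys)
  with assms show ?thesis
    using cons_red_cancel[OF reduced_word_foldr[OF assms], of x y ys] by auto
qed auto

lemma foldr_reduce_word: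
  "reduced_word w \<Longrightarrow> foldr cons_red (reduce_word u) w = foldr cons_red u w"
  by (induction u) (auto simp: reduce_word_def foldr_cons_red_cons_red)

lemma reduce_word_append: "reduce_word (u @ v) = foldr cons_red u (reduce_word v)"
  by (simp add: reduce_word_def)

lemma reduced_word_reduce_word: "reduced_word (reduce_word w)"
  by (simp add: reduce_word_def reduced_word_foldr)

lemma reduce_word_append_reduce_left: "reduce_word (reduce_word u @ v) = reduce_word (u @ v)"
  by (simp add: reduce_word_append foldr_reduce_word reduced_word_reduce_word)

lemma reduce_word_append_reduce_right: "reduce_word (u @ reduce_word v) = reduce_word (u @ v)"
  by (simp add: reduce_word_append reduce_word_reduced reduced_word_reduce_word)

lemma set_cons_red: "set (cons_red x w) \<subseteq> insert x (set w)"
  by (cases w) auto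

lemma set_reduce_word: "set (reduce_word w) \<subseteq> set w"
proof (induction w)
  case (Cons x w)
  then show ?case
    using set_cons_red[of x "reduce_word w"] by (auto simp: reduce_word_def)
qed (simp add: reduce_word_def)

definition inverse_word :: "'a fword \<Rightarrow> 'a fword" where
  "inverse_word w = rev (map (\<lambda>(b, x). (\<not> b, x)) w)"

lemma reduce_word_inverse_append:
  assumes "reduced_word v" shows "reduce_word (inverse_word w @ w @ v) = v"
  using assms
proof (induction w arbitrary: v)
  case Nil
  then show ?case
    by (simp add: inverse_word_def reduce_word_reduced)
next
  case (Cons x w)
  obtain b y where x: "x = (b, y)"
    by fastforce
  define v' where "v' = reduce_word (w @ v)"
  have "reduce_word (inverse_word (x # w) @ (x # w) @ v)
      = foldr cons_red (inverse_word w) (cons_red (\<not> b, y) (cons_red (b, y) v'))"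
    by (simp add: inverse_word_def reduce_word_def x v'_def)
  also have "\<dots> = foldr cons_red (inverse_word w) v'"
    by (simp add: cons_red_cancel v'_def reduced_word_reduce_word)
  also have "\<dots> = v"
    using Cons by (simp add: v'_def reduce_word_def)
  finally show ?case .
qed

lemma carrier_free_group: "w \<in> carrier (free_group S) \<longleftrightarrow> reduced_word w \<and> snd ` set w \<subseteq> S"
  by (simp add: free_group_def)

lemma mult_free_group: "u \<otimes>\<^bsub>free_group S\<^esub> v = reduce_word (u @ v)"
  by (simp add: free_group_def)

lemma one_free_group: "\<one>\<^bsub>free_group S\<^esub> = []"
  by (simp add: free_group_def)

lemma reduce_word_in_free_group:
  "snd ` set w \<subseteq> S \<Longrightarrow> reduce_word w \<in> carrier (free_group S)"
  using set_reduce_word[of w] reduced_word_reduce_word by (auto simp: carrier_free_group)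

lemma group_free_group: "group (free_group S)"
proof (rule groupI)
  fix u v w assume u: "u \<in> carrier (free_group S)" and v: "v \<in> carrier (free_group S)"
    and w: "w \<in> carrier (free_group S)"
  show "u \<otimes>\<^bsub>free_group S\<^esub> v \<in> carrier (free_group S)"
    unfolding mult_free_group
    using u v by (intro reduce_word_in_free_group) (auto simp: carrier_free_group)
  show "u \<otimes>\<^bsub>free_group S\<^esub> v \<otimes>\<^bsub>free_group S\<^esub> w = u \<otimes>\<^bsub>free_group S\<^esub> (v \<otimes>\<^bsub>free_group S\<^esub> w)"
    by (simp add: mult_free_group reduce_word_append_reduce_left reduce_word_append_reduce_right)
next
  show "\<one>\<^bsub>free_group S\<^esub> \<in> carrier (free_group S)"
    by (simp add: one_free_group carrier_free_group)
next
  fix u assume u: "u \<in> carrier (free_group S)"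
  show "\<one>\<^bsub>free_group S\<^esub> \<otimes>\<^bsub>free_group S\<^esub> u = u"
    using u by (simp add: one_free_group mult_free_group carrier_free_group reduce_word_reduced)
  have "reduce_word (inverse_word u) \<in> carrier (free_group S)"
    using u by (intro reduce_word_in_free_group) (auto simp: carrier_free_group inverse_word_def)
  moreover have "reduce_word (inverse_word u) \<otimes>\<^bsub>free_group S\<^esub> u = \<one>\<^bsub>free_group S\<^esub>"
    using reduce_word_inverse_append[of "[]" u]
    by (simp add: mult_free_group one_free_group reduce_word_append_reduce_left)
  ultimately show "\<exists>y\<in>carrier (free_group S). y \<otimes>\<^bsub>free_group S\<^esub> u = \<one>\<^bsub>free_group S\<^esub>"
    by blast
qed

section \<open>Heisenberg coordinates of words\<close>

fun exponent_sum :: "('a \<Rightarrow> int) \<Rightarrow> 'a fword \<Rightarrow> int" where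
  "exponent_sum f [] = 0"
| "exponent_sum f ((b, x) # w) = (if b then - f x else f x) + exponent_sum f w"

text \<open>The central coordinate of the image of a word in the integral Heisenberg group
  with multiplication (r, s, z) (r', s', z') = (r + r', s + s', z + z' + r s'),
  where a generator x is sent to (f x, g x, 0).\<close>

fun heisenberg_sum :: "('a \<Rightarrow> int) \<Rightarrow> ('a \<Rightarrow> int) \<Rightarrow> 'a fword \<Rightarrow> int" where
  "heisenberg_sum f g [] = 0"
| "heisenberg_sum f g ((b, x) # w) =
     (if b then f x * g x - f x * exponent_sum g w else f x * exponent_sum g w)
     + heisenberg_sum f g w"

lemma exponent_sum_append: "exponent_sum f (u @ v) = exponent_sum f u + exponent_sum f v"
  by (induction f u rule: exponent_sum.induct) auto

lemma heisenberg_sum_append: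
  "heisenberg_sum f g (u @ v) =
     heisenberg_sum f g u + heisenberg_sum f g v + exponent_sum f u * exponent_sum g v"
  by (induction f g u rule: heisenberg_sum.induct) (auto simp: exponent_sum_append algebra_simps)

lemma exponent_sum_cons_red: "exponent_sum f (cons_red x w) = exponent_sum f (x # w)"
  by (cases x; cases w) (auto split: if_splits)

text \<open>The term \<open>f x * g x\<close> for an inverse letter is the central coordinate of the
  inverse of (f x, g x, 0). With it, two adjacent opposite letters contribute nothing, so
  cancellation preserves the sum.\<close>

lemma heisenberg_sum_cons_red: "heisenberg_sum f g (cons_red x w) = heisenberg_sum f g (x # w)"
  by (cases x; cases w) (auto simp: algebra_simps split: if_splits)

lemma exponent_sum_reduce_word: "exponent_sum f (reduce_word w) = exponent_sum f w"
proof (induction w)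
  case (Cons x w)
  then show ?case
    by (cases x) (auto simp: reduce_word_def exponent_sum_cons_red)
qed (simp add: reduce_word_def)

lemma heisenberg_sum_reduce_word: "heisenberg_sum f g (reduce_word w) = heisenberg_sum f g w"
proof (induction w)
  case (Cons x w)
  have "exponent_sum g (foldr cons_red w []) = exponent_sum g w"
    using exponent_sum_reduce_word[of g w] by (simp add: reduce_word_def)
  with Cons show ?case
    by (cases x) (auto simp: reduce_word_def heisenberg_sum_cons_red)
qed (simp add: reduce_word_def)

lemma exponent_sum_mult:
  "exponent_sum f (u \<otimes>\<^bsub>free_group S\<^esub> v) = exponent_sum f u + exponent_sum f v"
  by (simp add: mult_free_group exponent_sum_reduce_word exponent_sum_append)

lemma heisenberg_sum_mult:
  "heisenberg_sum f g (u \<otimes>\<^bsub>free_group S\<^esub> v) =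
     heisenberg_sum f g u + heisenberg_sum f g v + exponent_sum f u * exponent_sum g v"
  by (simp add: mult_free_group heisenberg_sum_reduce_word heisenberg_sum_append)

lemma exponent_sum_inv:
  assumes "u \<in> carrier (free_group S)"
  shows "exponent_sum f (inv\<^bsub>free_group S\<^esub> u) = - exponent_sum f u"
proof -
  interpret F: group "free_group S" by (rule group_free_group)
  have "exponent_sum f (inv\<^bsub>free_group S\<^esub> u \<otimes>\<^bsub>free_group S\<^esub> u) = 0"
    using assms by (simp add: one_free_group)
  then show ?thesis
    by (simp add: exponent_sum_mult)
qed

lemma heisenberg_sum_inv:
  assumes "u \<in> carrier (free_group S)"
  shows "heisenberg_sum f g (inv\<^bsub>free_group S\<^esub> u) =
    exponent_sum f u * exponent_sum g u - heisenberg_sum f g u"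
proof -
  interpret F: group "free_group S" by (rule group_free_group)
  have "heisenberg_sum f g (inv\<^bsub>free_group S\<^esub> u \<otimes>\<^bsub>free_group S\<^esub> u) = 0"
    using assms by (simp add: one_free_group)
  then show ?thesis
    unfolding heisenberg_sum_mult exponent_sum_inv[OF assms] by simp
qed

lemma exponent_sum_commutator:
  assumes "u \<in> carrier (free_group S)" "v \<in> carrier (free_group S)"
  shows "exponent_sum f (u \<otimes>\<^bsub>free_group S\<^esub> v \<otimes>\<^bsub>free_group S\<^esub> inv\<^bsub>free_group S\<^esub> u
    \<otimes>\<^bsub>free_group S\<^esub> inv\<^bsub>free_group S\<^esub> v) = 0"
  using assms by (simp add: exponent_sum_mult exponent_sum_inv)

text \<open>The result depends on u and v only through their exponent sums and is bilinear in them.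
  Divisibility of the exponent sums of u alone thus passes to the commutator.\<close>

lemma heisenberg_sum_commutator:
  assumes "u \<in> carrier (free_group S)" "v \<in> carrier (free_group S)"
  shows "heisenberg_sum f g (u \<otimes>\<^bsub>free_group S\<^esub> v \<otimes>\<^bsub>free_group S\<^esub> inv\<^bsub>free_group S\<^esub> u
    \<otimes>\<^bsub>free_group S\<^esub> inv\<^bsub>free_group S\<^esub> v)
    = exponent_sum f u * exponent_sum g v - exponent_sum f v * exponent_sum g u"
  using assms
  by (simp add: heisenberg_sum_mult exponent_sum_mult heisenberg_sum_inv exponent_sum_inv
      algebra_simps)

text \<open>With this the cross term in \<open>heisenberg_sum_mult\<close> vanishes, so the central
  coordinate is additive on the derived subgroup.\<close>

lemma exponent_sum_derived:
  assumes "w \<in> derived (free_group S) (carrier (free_group S))"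
  shows "exponent_sum f w = 0"
proof -
  interpret F: group "free_group S" by (rule group_free_group)
  have sub: "derived_set (free_group S) (carrier (free_group S)) \<subseteq> carrier (free_group S)"
    by (rule F.derived_set_in_carrier) simp
  show ?thesis
    using assms unfolding derived_def
  proof (induction rule: generate.induct)
    case (incl h)
    then show ?case by (auto simp: exponent_sum_commutator)
  next
    case (inv h)
    then have "h \<in> carrier (free_group S)" "exponent_sum f h = 0"
      using sub by (auto simp: exponent_sum_commutator)
    then show ?case by (simp add: exponent_sum_inv)
  qed (simp_all add: one_free_group exponent_sum_mult)
qed

section \<open>Groups with cyclic coordinates\<close>

text \<open>An isomorphism of G onto the product of the cyclic groups of orders q 0, ..., q (d - 1),
  written as integer-valued functions so that the coordinates can serve as weights of letters.
  Values are the representatives in 0..<q i: this follows from \<open>coord_mult\<close> with the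
  unit as second factor.\<close>

locale cyclic_coordinates = comm_group G for G (structure) +
  fixes q :: "nat \<Rightarrow> nat" and d :: nat and c :: "'a \<Rightarrow> nat \<Rightarrow> int"
  assumes modulus_pos: "i < d \<Longrightarrow> 0 < q i"
    and coord_mult: "\<lbrakk>x \<in> carrier G; y \<in> carrier G; i < d\<rbrakk> \<Longrightarrow> c (x \<otimes> y) i = (c x i + c y i) mod int (q i)"
    and coord_inject: "\<lbrakk>x \<in> carrier G; y \<in> carrier G; \<And>i. i < d \<Longrightarrow> c x i = c y i\<rbrakk> \<Longrightarrow> x = y"
    and coord_surj: "\<exists>x\<in>carrier G. \<forall>i<d. c x i = f i mod int (q i)"
begin

lemma coord_mod: "x \<in> carrier G \<Longrightarrow> i < d \<Longrightarrow> c x i mod int (q i) = c x i"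
  by (metis coord_mult mod_mod_trivial one_closed r_one)

lemma coord_range:
  assumes "x \<in> carrier G" "i < d" shows "c x i \<in> {0..<int (q i)}"
  using pos_mod_bound[of "int (q i)" "c x i"] pos_mod_sign[of "int (q i)" "c x i"]
    modulus_pos[OF assms(2)] by (simp add: coord_mod[OF assms])

lemma coord_one: "i < d \<Longrightarrow> c \<one> i = 0"
proof -
  assume i: "i < d"
  have "int (q i) dvd c \<one> i + c \<one> i - c \<one> i"
    using coord_mult[of \<one> \<one> i] i coord_mod[of \<one> i] by (metis l_one mod_eq_dvd_iff one_closed)
  then show ?thesis
    using coord_mod[of \<one> i] i by simp
qed

lemma coord_inv:
  assumes "x \<in> carrier G" "i < d" shows "c (inv x) i = - c x i mod int (q i)"
proof -
  have "(c (inv x) i + c x i) mod int (q i) = 0"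
    using assms coord_mult[of "inv x" x i] coord_one by simp
  then have "c (inv x) i mod int (q i) = - c x i mod int (q i)"
    by (simp add: mod_eq_dvd_iff dvd_eq_mod_eq_0)
  then show ?thesis
    using assms coord_mod by simp
qed

lemma coord_pow:
  assumes "x \<in> carrier G" "i < d" shows "c (x [^] k) i = int k * c x i mod int (q i)"
proof (induction k)
  case (Suc k)
  then show ?case
    using assms by (simp add: coord_mult mod_simps algebra_simps)
qed (use assms in \<open>simp add: coord_one\<close>)

lemma coord_eq_one_iff: "x \<in> carrier G \<Longrightarrow> x = \<one> \<longleftrightarrow> (\<forall>i<d. c x i = 0)"
  using coord_inject[of x \<one>] coord_one by auto

lemma ex_unit_vector:
  assumes "\<And>i. i < d \<Longrightarrow> 1 < q i"
  shows "\<exists>x\<in>carrier G. \<forall>i<d. c x i = (if i = m then 1 else 0)"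
proof -
  obtain x where "x \<in> carrier G" "\<forall>i<d. c x i = (if i = m then 1 else 0) mod int (q i)"
    using coord_surj[of "\<lambda>i. if i = m then 1 else 0"] by blast
  then show ?thesis
    using assms by (intro bexI[of _ x]) auto
qed

text \<open>Applied with the full ranges to get the order of G, and with the multiples of p to get
  the order of the Frattini subgroup.\<close>

lemma card_coord_set:
  assumes "\<And>i. i < d \<Longrightarrow> A i \<subseteq> {0..<int (q i)}"
  shows "card {x \<in> carrier G. \<forall>i<d. c x i \<in> A i} = (\<Prod>i<d. card (A i))"
proof -
  let ?r = "\<lambda>x. restrict (c x) {..<d}"
  let ?S = "{x \<in> carrier G. \<forall>i<d. c x i \<in> A i}"
  have "inj_on ?r ?S"
  proof (rule inj_onI)
    fix x y assume x: "x \<in> ?S" and y: "y \<in> ?S" and eq: "?r x = ?r y"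
    have "c x i = c y i" if "i < d" for i
      using fun_cong[OF eq, of i] that by simp
    then show "x = y"
      using x y by (intro coord_inject) auto
  qed
  moreover have "?r ` ?S = PiE {..<d} A"
  proof (intro equalityI subsetI)
    fix f assume f: "f \<in> PiE {..<d} A"
    obtain x where x: "x \<in> carrier G" "\<forall>i<d. c x i = f i mod int (q i)"
      using coord_surj by blast
    have cf: "c x i = f i" if "i < d" for i
    proof -
      have "f i \<in> {0..<int (q i)}"
        using assms[OF that] f that by blast
      then show ?thesis
        using x(2) that by simp
    qed
    have "c x i \<in> A i" if "i < d" for i
      using cf[OF that] f that by auto
    moreover have "f = ?r x"
      using f cf by (intro PiE_ext[of _ "{..<d}" A]) (auto simp: PiE_iff)
    ultimately show "f \<in> ?r ` ?S"
      using x(1) by blast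
  qed auto
  ultimately have "card ?S = card (PiE {..<d} A)"
    using card_image[of ?r ?S] by simp
  then show ?thesis
    by (simp add: card_PiE)
qed

lemma order_eq: "order G = (\<Prod>i<d. q i)"
proof -
  have "{x \<in> carrier G. \<forall>i<d. c x i \<in> {0..<int (q i)}} = carrier G"
    using coord_range by auto
  then show ?thesis
    using card_coord_set[of "\<lambda>i. {0..<int (q i)}"] by (simp add: order_def)
qed

section \<open>Words in coordinates and the lower bound for the Schur multiplier\<close>

lemma eval_word_Cons: "eval_word G ((b, x) # w) = (if b then inv x else x) \<otimes> eval_word G w"
  by (simp add: eval_word_def)

lemma eval_word_closed: "snd ` set w \<subseteq> carrier G \<Longrightarrow> eval_word G w \<in> carrier G"
proof (induction w)
  case (Cons z w)
  then show ?case
    by (cases z) (simp add: eval_word_Cons)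
qed (simp add: eval_word_def)

lemma coord_eval_word:
  assumes "snd ` set w \<subseteq> carrier G" "i < d"
  shows "c (eval_word G w) i = exponent_sum (\<lambda>x. c x i) w mod int (q i)"
  using assms
proof (induction w)
  case Nil
  then show ?case by (simp add: eval_word_def coord_one)
next
  case (Cons z w)
  then show ?case
    by (cases z) (simp add: eval_word_Cons eval_word_closed coord_mult coord_inv mod_simps)
qed

lemma hopf_R_iff:
  "w \<in> hopf_R G \<longleftrightarrow> w \<in> carrier (free_group (carrier G)) \<and>
     (\<forall>i<d. int (q i) dvd exponent_sum (\<lambda>x. c x i) w)"
proof -
  have "eval_word G w = \<one> \<longleftrightarrow> (\<forall>i<d. int (q i) dvd exponent_sum (\<lambda>x. c x i) w)"
    if w: "snd ` set w \<subseteq> carrier G"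
  proof -
    have "eval_word G w = \<one> \<longleftrightarrow> (\<forall>i<d. c (eval_word G w) i = 0)"
      using coord_eq_one_iff eval_word_closed[OF w] by blast
    then show ?thesis
      using coord_eval_word[OF w] by (simp add: dvd_eq_mod_eq_0)
  qed
  then show ?thesis
    by (auto simp: hopf_R_def kernel_def carrier_free_group)
qed

abbreviation "coord_exponent i w \<equiv> exponent_sum (\<lambda>x. c x i) w"
abbreviation "coord_area i j w \<equiv> heisenberg_sum (\<lambda>x. c x i) (\<lambda>x. c x j) w"

text \<open>A generator [u, v] has u in R, so both exponent sums of u in the determinant are
  divisible by the gcd. The three claims are proved together: zero exponent sums make the area
  additive under products, and membership in the carrier is needed for the inverse formulas.\<close>

lemma heisenberg_sum_comm_subgroup:
  assumes "w \<in> comm_subgroup (free_group (carrier G)) (hopf_R G) (carrier (free_group (carrier G)))"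
    and "i < d" "j < d"
  shows "w \<in> carrier (free_group (carrier G)) \<and> (\<forall>i. coord_exponent i w = 0) \<and> int (gcd (q i) (q j)) dvd coord_area i j w"
proof -
  interpret F: group "free_group (carrier G)" by (rule group_free_group)
  have comm: "u \<otimes>\<^bsub>free_group (carrier G)\<^esub> v \<otimes>\<^bsub>free_group (carrier G)\<^esub>
      inv\<^bsub>free_group (carrier G)\<^esub> u \<otimes>\<^bsub>free_group (carrier G)\<^esub> inv\<^bsub>free_group (carrier G)\<^esub> v
        \<in> carrier (free_group (carrier G)) \<and>
      int (gcd (q i) (q j)) dvd coord_area i j (u \<otimes>\<^bsub>free_group (carrier G)\<^esub> v \<otimes>\<^bsub>free_group (carrier G)\<^esub>
      inv\<^bsub>free_group (carrier G)\<^esub> u \<otimes>\<^bsub>free_group (carrier G)\<^esub> inv\<^bsub>free_group (carrier G)\<^esub> v)"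
    if "u \<in> hopf_R G" "v \<in> carrier (free_group (carrier G))" for u v
  proof -
    have u: "u \<in> carrier (free_group (carrier G))" "int (q i) dvd coord_exponent i u" "int (q j) dvd coord_exponent j u"
      using that assms(2,3) by (auto simp: hopf_R_iff)
    have "int (gcd (q i) (q j)) dvd coord_exponent i u" "int (gcd (q i) (q j)) dvd coord_exponent j u"
      using u(2,3) by (meson dvd_trans gcd_dvd1 gcd_dvd2 int_dvd_int_iff)+
    then show ?thesis
      using u(1) that(2) by (simp add: heisenberg_sum_commutator)
  qed
  show ?thesis
    using assms(1) unfolding comm_subgroup_def
  proof (induction rule: generate.induct)
    case (incl h)
    then show ?case
      using comm by (auto simp: exponent_sum_commutator hopf_R_iff)
  next
    case (inv h)
    then have "h \<in> carrier (free_group (carrier G))" "\<forall>i. coord_exponent i h = 0" "int (gcd (q i) (q j)) dvd coord_area i j h"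
      using comm by (auto simp: exponent_sum_commutator hopf_R_iff)
    then show ?case
      by (simp add: exponent_sum_inv heisenberg_sum_inv)
  next
    case one
    then show ?case
      by (simp add: one_free_group carrier_free_group)
  next
    case (eng h1 h2)
    then show ?case
      using F.m_closed by (simp add: exponent_sum_mult heisenberg_sum_mult)
  qed
qed

text \<open>The word is a product of powers of commutators [x, y], where x and y are generators of F
  that are unit vectors in G. Induction on the set T of pairs treated so far adds one factor at a
  time.\<close>

lemma ex_word_heisenberg_sum:
  assumes "finite T" "T \<subseteq> {(i, j). i < j \<and> j < d}" "\<And>i. i < d \<Longrightarrow> 1 < q i"
  shows "\<exists>w \<in> hopf_R G \<inter> derived (free_group (carrier G)) (carrier (free_group (carrier G))).
    \<forall>i j. i < j \<and> j < d \<longrightarrow> coord_area i j w = (if (i, j) \<in> T then int (v i j) else 0)"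
  using assms(1,2)
proof (induction T)
  case empty
  interpret F: group "free_group (carrier G)" by (rule group_free_group)
  show ?case
    using subgroup.one_closed[OF F.derived_is_subgroup[of "carrier (free_group (carrier G))"]]
    by (intro bexI[of _ "[]"]) (auto simp: hopf_R_iff carrier_free_group one_free_group)
next
  case (insert kl T)
  let ?F = "free_group (carrier G)"
  interpret F: group ?F by (rule group_free_group)
  interpret D: subgroup "derived ?F (carrier ?F)" ?F
    by (rule F.derived_is_subgroup) simp
  obtain k l where kl: "kl = (k, l)" "k < l" "l < d"
    using insert.prems by (cases kl) auto
  obtain x where x: "x \<in> carrier G" "\<forall>i<d. c x i = (if i = k then 1 else 0)"
    using ex_unit_vector[OF assms(3)] by blast
  obtain y where y: "y \<in> carrier G" "\<forall>i<d. c y i = (if i = l then 1 else 0)"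
    using ex_unit_vector[OF assms(3)] by blast
  define x1 y1 where "x1 = [(False, x)]" and "y1 = [(False, y)]"
  have xy1: "x1 \<in> carrier ?F" "y1 \<in> carrier ?F"
    using x y by (auto simp: x1_def y1_def carrier_free_group)
  define K where "K = x1 \<otimes>\<^bsub>?F\<^esub> y1 \<otimes>\<^bsub>?F\<^esub> inv\<^bsub>?F\<^esub> x1 \<otimes>\<^bsub>?F\<^esub> inv\<^bsub>?F\<^esub> y1"
  have KD: "K \<in> derived ?F (carrier ?F)"
    unfolding derived_def K_def using xy1 by (intro generate.incl) blast
  have derived_R: "w \<in> hopf_R G" if "w \<in> derived ?F (carrier ?F)" for w
    using that D.mem_carrier by (simp add: hopf_R_iff exponent_sum_derived)
  \<comment> \<open>The second term of the determinant could be nonzero only for (i, j) = (l, k),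
    which i < j and k < l exclude.\<close>
  have area_K: "coord_area i j K = (if (i, j) = (k, l) then 1 else 0)" if "i < j" "j < d" for i j
    using that kl x y unfolding K_def heisenberg_sum_commutator[OF xy1] by (auto simp: x1_def y1_def)
  have area_mult: "coord_area i j (u \<otimes>\<^bsub>?F\<^esub> w) = coord_area i j u + coord_area i j w" if "u \<in> derived ?F (carrier ?F)" for i j u w
    using that by (simp add: heisenberg_sum_mult exponent_sum_derived)
  have pow: "K [^]\<^bsub>?F\<^esub> (s::nat) \<in> derived ?F (carrier ?F) \<and> coord_area i j (K [^]\<^bsub>?F\<^esub> s) = int s * coord_area i j K" for s i j
  proof (induction s)
    case 0
    have "coord_area i j \<one>\<^bsub>?F\<^esub> = 0" by (simp add: one_free_group)
    then show ?case by simp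
  next
    case (Suc s)
    then show ?case using KD by (simp add: area_mult algebra_simps)
  qed
  obtain w where w: "w \<in> derived ?F (carrier ?F)"
    "\<forall>i j. i < j \<and> j < d \<longrightarrow> coord_area i j w = (if (i, j) \<in> T then int (v i j) else 0)"
    using insert.IH insert.prems by blast
  show ?case
  proof (intro bexI allI impI)
    show "w \<otimes>\<^bsub>?F\<^esub> K [^]\<^bsub>?F\<^esub> v k l \<in> hopf_R G \<inter> derived ?F (carrier ?F)"
      using w pow[of "v k l"] derived_R by simp
    fix i j assume "i < j \<and> j < d"
    then show "coord_area i j (w \<otimes>\<^bsub>?F\<^esub> K [^]\<^bsub>?F\<^esub> v k l) = (if (i, j) \<in> insert kl T then int (v i j) else 0)"
      using w pow[of "v k l" i j] area_K[of i j] insert.hyps(2) kl(1) by (auto simp: area_mult)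
  qed
qed

text \<open>Each choice v of residues modulo the gcds is realised as areas of a word W v. If two
  such words lie in the same coset of [R, F], their areas agree modulo the gcds, so the choices are
  equal. This injects a set whose size is the product of the gcds.\<close>

lemma schur_multiplier_ge:
  assumes "\<And>i. i < d \<Longrightarrow> 1 < q i" and nz: "order (schur_multiplier G) \<noteq> 0"
  shows "(\<Prod>j<d. \<Prod>i<j. gcd (q i) (q j)) \<le> order (schur_multiplier G)"
proof -
  let ?F = "free_group (carrier G)"
  interpret F: group ?F by (rule group_free_group)
  define D where "D = derived ?F (carrier ?F)"
  define N where "N = comm_subgroup ?F (hopf_R G) (carrier ?F)"
  \<comment> \<open>The larger index comes first, so that P is a dependent sum matching the nested
    product in the claim.\<close>
  define P where "P = (SIGMA j:{..<d}. {..<j})"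
  define V where "V = PiE P (\<lambda>(j, i). {..<gcd (q i) (q j)})"
  have carrier: "carrier (schur_multiplier G) = (\<lambda>w. N #>\<^bsub>?F\<^esub> w) ` (hopf_R G \<inter> D)"
    by (auto simp: schur_multiplier_def Let_def FactGroup_def RCOSETS_def r_coset_def N_def D_def)
  have "\<exists>w \<in> hopf_R G \<inter> D. \<forall>i j. i < j \<and> j < d \<longrightarrow> coord_area i j w = int (v (j, i))" for v
  proof -
    have "finite {(i, j). i < j \<and> j < d}"
      by (rule finite_subset[of _ "{..<d} \<times> {..<d}"]) auto
    from ex_word_heisenberg_sum[OF this subset_refl assms(1), of "\<lambda>i j. v (j, i)"]
    show ?thesis
      by (auto simp: D_def)
  qed
  then obtain W where W: "\<And>v. W v \<in> hopf_R G \<inter> D"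
    "\<And>v i j. i < j \<Longrightarrow> j < d \<Longrightarrow> coord_area i j (W v) = int (v (j, i))"
    by metis
  have "inj_on (\<lambda>v. N #>\<^bsub>?F\<^esub> W v) V"
  proof (rule inj_onI)
    fix v v' assume v: "v \<in> V" "v' \<in> V" and eq: "N #>\<^bsub>?F\<^esub> W v = N #>\<^bsub>?F\<^esub> W v'"
    have Wc: "W v \<in> carrier ?F"
      using W(1)[of v] by (simp add: hopf_R_iff)
    have "W v = \<one>\<^bsub>?F\<^esub> \<otimes>\<^bsub>?F\<^esub> W v"
      using Wc by simp
    moreover have "\<one>\<^bsub>?F\<^esub> \<in> N"
      unfolding N_def comm_subgroup_def by (rule generate.one)
    ultimately have "W v \<in> N #>\<^bsub>?F\<^esub> W v'"
      unfolding eq[symmetric] by (auto simp: r_coset_def)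
    then obtain n where n: "n \<in> N" "W v = n \<otimes>\<^bsub>?F\<^esub> W v'"
      by (auto simp: r_coset_def)
    have "v (j, i) = v' (j, i)" if "(j, i) \<in> P" for i j
    proof -
      have ij: "i < j" "j < d" "i < d"
        using that by (auto simp: P_def)
      have *: "coord_exponent i n = 0" "int (gcd (q i) (q j)) dvd coord_area i j n"
        using heisenberg_sum_comm_subgroup[of n i j] n ij by (auto simp: N_def)
      have "coord_area i j (W v) = coord_area i j n + coord_area i j (W v')"
        unfolding n(2) using *(1) by (simp add: heisenberg_sum_mult)
      then have "int (gcd (q i) (q j)) dvd int (v (j, i)) - int (v' (j, i))"
        using * W(2) ij by simp
      moreover have "v (j, i) < gcd (q i) (q j)" "v' (j, i) < gcd (q i) (q j)"
        using v that by (auto simp: V_def PiE_iff)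
      ultimately show ?thesis
        by (metis mod_eq_dvd_iff mod_less of_nat_eq_iff zmod_int)
    qed
    then show "v = v'"
      using v unfolding V_def by (intro PiE_ext) auto
  qed
  moreover have "(\<lambda>v. N #>\<^bsub>?F\<^esub> W v) ` V \<subseteq> carrier (schur_multiplier G)"
    using W(1) by (auto simp: carrier)
  \<comment> \<open>\<open>order\<close> is 0 on an infinite carrier; \<open>nz\<close> excludes
    this, and the injection then bounds the cardinality.\<close>
  moreover have "finite (carrier (schur_multiplier G))"
    using nz by (metis card.infinite order_def)
  ultimately have "card V \<le> order (schur_multiplier G)"
    unfolding order_def by (rule card_inj_on_le)
  moreover have "card V = (\<Prod>j<d. \<Prod>i<j. gcd (q i) (q j))"
    by (simp add: V_def P_def card_PiE prod.Sigma case_prod_beta)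
  ultimately show ?thesis
    by simp
qed

end

section \<open>Finite abelian p-groups\<close>

lemma (in comm_group) subgroup_cyclic_set_mult:
  assumes "subgroup H G" "x \<in> carrier G"
  shows "subgroup {x [^] k \<otimes> h | (k::int) h. h \<in> H} G" (is "subgroup ?K G")
proof (rule subgroupI)
  interpret H: subgroup H G by fact
  show "?K \<subseteq> carrier G"
    using assms(2) by auto
  show "?K \<noteq> {}"
    using H.one_closed by blast
  show "inv a \<in> ?K" if a: "a \<in> ?K" for a
  proof -
    obtain k h where "a = x [^] (k::int) \<otimes> h" "h \<in> H"
      using a by blast
    moreover from this have "inv a = x [^] (- k) \<otimes> inv h"
      using assms(2) by (simp add: inv_mult int_pow_neg)
    ultimately show ?thesis
      using H.m_inv_closed by blast
  qed
  show "a \<otimes> b \<in> ?K" if ab: "a \<in> ?K" "b \<in> ?K" for a b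
  proof -
    obtain k h l h' where "a = x [^] (k::int) \<otimes> h" "h \<in> H" "b = x [^] (l::int) \<otimes> h'" "h' \<in> H"
      using ab by blast
    moreover from this have "a \<otimes> b = x [^] (k + l) \<otimes> (h \<otimes> h')"
      using assms(2) by (simp add: int_pow_mult m_ac)
    ultimately show ?thesis
      using H.m_closed by blast
  qed
qed

text \<open>The complement is a maximal subgroup H meeting the cyclic group of x trivially. If x and H
  did not span, some g outside their span would have its p-th power inside; since x has maximal
  order, g can be corrected by a power of x to y with y^p in H, and adjoining y enlarges H.\<close>

lemma (in comm_group) cyclic_complement:
  assumes "finite (carrier G)" "Factorial_Ring.prime p" "x \<in> carrier G" "ord x = p ^ e"
    and exponent: "\<And>y. y \<in> carrier G \<Longrightarrow> y [^] (p ^ e) = \<one>"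
  obtains H where "subgroup H G" "\<And>k::int. x [^] k \<in> H \<Longrightarrow> x [^] k = \<one>"
    "\<And>g. g \<in> carrier G \<Longrightarrow> \<exists>(k::int) h. h \<in> H \<and> g = x [^] k \<otimes> h"
proof -
  define S where "S = {H. subgroup H G \<and> (\<forall>k::int. x [^] k \<in> H \<longrightarrow> x [^] k = \<one>)}"
  have "S \<subseteq> Pow (carrier G)"
    by (auto simp: S_def dest: subgroup.subset)
  then have "finite S"
    using assms(1) by (meson finite_Pow_iff finite_subset)
  moreover have "{\<one>} \<in> S"
    by (auto simp: S_def triv_subgroup)
  ultimately obtain H where H: "H \<in> S" and max: "\<And>K. K \<in> S \<Longrightarrow> H \<subseteq> K \<Longrightarrow> H = K"
    using finite_has_maximal[of S] by blast
  interpret H: subgroup H G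
    using H by (simp add: S_def)
  define C where "C = {x [^] k \<otimes> h | (k::int) h. h \<in> H}"
  interpret C: subgroup C G
    unfolding C_def using assms(3) H.subgroup_axioms by (rule subgroup_cyclic_set_mult[rotated])
  have HC: "H \<subseteq> C"
  proof
    fix h assume "h \<in> H"
    then have "h = x [^] (0::int) \<otimes> h" by simp
    with \<open>h \<in> H\<close> show "h \<in> C" unfolding C_def by blast
  qed
  have xC: "x [^] (k::int) \<in> C" for k
  proof -
    have "x [^] k = x [^] k \<otimes> \<one>" using assms(3) by simp
    then show ?thesis unfolding C_def using H.one_closed by blast
  qed
  have "g0 \<in> C" if g0: "g0 \<in> carrier G" for g0
  proof (rule ccontr)
    assume "g0 \<notin> C"
    define r where "r = (LEAST r. g0 [^] (p ^ r) \<in> C)"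
    have r: "g0 [^] (p ^ r) \<in> C"
      unfolding r_def by (rule LeastI[of _ e]) (simp add: exponent g0)
    have "r \<noteq> 0"
      using r g0 \<open>g0 \<notin> C\<close> by (auto intro: ccontr)
    then obtain r' where r': "r = Suc r'"
      using not0_implies_Suc by blast
    define g where "g = g0 [^] (p ^ r')"
    have g: "g \<in> carrier G"
      using g0 by (simp add: g_def)
    have "g \<notin> C"
      unfolding g_def using not_less_Least[of r' "\<lambda>r. g0 [^] (p ^ r) \<in> C"] r' by (simp add: r_def)
    have "g [^] p \<in> C"
      using r g0 by (simp add: r' g_def nat_pow_pow mult.commute)
    then obtain k h where kh: "g [^] p = x [^] (k::int) \<otimes> h" "h \<in> H"
      by (auto simp: C_def)
    have "e \<noteq> 0"
      using exponent[OF g] g \<open>g \<notin> C\<close> C.one_closed by (metis nat_pow_eone power_0)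
    then obtain e' where e': "e = Suc e'"
      using not0_implies_Suc by blast
    \<comment> \<open>Raising g^p = x^k h to the power p^(e - 1) gives the unit on the left, so a
      power of x lies in H and is trivial. As x has order p^e, this makes p divide k.\<close>
    have "\<one> = (g [^] p) [^] (p ^ e')"
      using exponent[OF g] g by (simp add: e' nat_pow_pow)
    also have "\<dots> = (x [^] k) [^] (p ^ e') \<otimes> h [^] (p ^ e')"
      using assms(3) kh by (simp add: nat_pow_distrib)
    also have "(x [^] k) [^] (p ^ e') = x [^] (k * int (p ^ e'))"
      using assms(3) by (metis int_pow_int int_pow_pow)
    finally have "x [^] (k * int (p ^ e')) = inv (h [^] (p ^ e'))"
      using kh assms(3) by (metis H.mem_carrier inv_equality int_pow_closed nat_pow_closed)
    also have "\<dots> \<in> H"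
      using kh H.subgroup_axioms by (metis H.m_inv_closed int_pow_int subgroup_int_pow_closed)
    finally have "x [^] (k * int (p ^ e')) = \<one>"
      using H by (simp add: S_def)
    then have "int (p ^ e) dvd k * int (p ^ e')"
      using assms(3,4) int_pow_eq_id by simp
    then have "int p dvd k"
      using prime_gt_0_nat[OF assms(2)] by (simp add: e')
    then obtain l where l: "k = int p * l" ..
    define y where "y = g \<otimes> x [^] (- l)"
    have y: "y \<in> carrier G"
      using g assms(3) by (simp add: y_def)
    have yp: "y [^] int p = h"
    proof -
      have "y [^] int p = g [^] int p \<otimes> x [^] (- k)"
        using g assms(3) by (simp add: y_def int_pow_distrib int_pow_pow l mult.commute)
      also have "\<dots> = x [^] k \<otimes> x [^] (- k) \<otimes> h"
        using kh assms(3) by (simp add: int_pow_int m_ac)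
      also have "\<dots> = h"
        using kh assms(3) by (simp flip: int_pow_mult)
      finally show ?thesis .
    qed
    have "y \<notin> C"
    proof
      assume "y \<in> C"
      then have "y \<otimes> x [^] l \<in> C"
        using xC by blast
      moreover have "y \<otimes> x [^] l = g"
        using g assms(3) by (simp add: y_def m_assoc flip: int_pow_mult)
      ultimately show False
        using \<open>g \<notin> C\<close> by simp
    qed
    define K where "K = {y [^] j \<otimes> h | (j::int) h. h \<in> H}"
    have subK: "subgroup K G"
      unfolding K_def using y H.subgroup_axioms by (rule subgroup_cyclic_set_mult[rotated])
    have "H \<subseteq> K"
    proof
      fix h assume "h \<in> H"
      then have "h = y [^] (0::int) \<otimes> h" by simp
      with \<open>h \<in> H\<close> show "h \<in> K" unfolding K_def by blast
    qed
    moreover have "y \<in> K"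
    proof -
      have "y = y [^] (1::int) \<otimes> \<one>" using y by simp
      then show ?thesis unfolding K_def using H.one_closed by blast
    qed
    ultimately have "K \<notin> S"
      using max HC \<open>y \<notin> C\<close> by blast
    then obtain i :: int where i: "x [^] i \<in> K" "x [^] i \<noteq> \<one>"
      using subK by (auto simp: S_def)
    obtain j h' where jh: "x [^] i = y [^] (j::int) \<otimes> h'" "h' \<in> H"
      using i by (auto simp: K_def)
    \<comment> \<open>If p divides j, then y^j is a power of y^p = h, which puts x^i into H.
      Otherwise Bezout recovers y from y^p and y^j, both in C.\<close>
    show False
    proof (cases "int p dvd j")
      case True
      then obtain j' where "j = int p * j'" ..
      then have "y [^] j = h [^] j'"
        using y by (simp add: int_pow_pow flip: yp)
      then have "x [^] i \<in> H"
        using jh kh subgroup_int_pow_closed[OF H.subgroup_axioms] by simp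
      then show False
        using i H by (simp add: S_def)
    next
      case False
      then have "coprime (int p) j"
        using assms(2) by (simp add: prime_imp_coprime)
      then obtain u v where uv: "u * int p + v * j = 1"
        using bezout_int[of "int p" j] by (auto simp: coprime_iff_gcd_eq_1)
      have "y [^] j = x [^] i \<otimes> inv h'"
        using jh y assms(3) by (simp add: m_assoc)
      also have "\<dots> \<in> C"
        using jh(2) HC by (intro C.m_closed C.m_inv_closed xC) blast
      finally have "y [^] j \<in> C" .
      moreover have "y [^] int p \<in> C"
        using yp kh HC by auto
      ultimately have "(y [^] int p) [^] u \<otimes> (y [^] j) [^] v \<in> C"
        using subgroup_int_pow_closed[OF C.subgroup_axioms] by blast
      also have "(y [^] int p) [^] u \<otimes> (y [^] j) [^] v = y [^] (u * int p + v * j)"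
        using y by (simp add: int_pow_pow int_pow_mult mult.commute)
      finally show False
        using uv y \<open>y \<notin> C\<close> by simp
    qed
  qed
  then have span: "\<exists>(k::int) h. h \<in> H \<and> g = x [^] k \<otimes> h" if "g \<in> carrier G" for g
    using that unfolding C_def by blast
  have "x [^] k = \<one>" if "x [^] k \<in> H" for k :: int
    using H that by (simp add: S_def)
  from that[OF H.subgroup_axioms this span] show thesis .
qed

lemma (in comm_group) subgroup_comm_group: "subgroup H G \<Longrightarrow> comm_group (G\<lparr>carrier := H\<rparr>)"
  by (intro group.group_comm_groupI subgroup_imp_group) (auto intro: m_comm dest: subgroup.mem_carrier)

text \<open>A cyclic factor of maximal order is split off and becomes coordinate 0; the complement
  supplies the others, shifted by one. The induction hypothesis is an explicit assumption because
  the induction has to vary G, which is fixed in this context.\<close>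

lemma (in comm_group) ex_prime_power_coordinates_step:
  assumes fin: "finite (carrier G)" and prime: "Factorial_Ring.prime p" and order: "order G = p ^ n"
    and IH: "\<And>H m. \<lbrakk>subgroup H G; m < n; card H = p ^ m\<rbrakk> \<Longrightarrow>
      \<exists>d e c. cyclic_coordinates (G\<lparr>carrier := H\<rparr>) (\<lambda>i. p ^ e i) d c \<and> (\<forall>i<d. 0 < e i) \<and>
        (\<forall>j<d. \<forall>i<j. e j \<le> e i)"
  shows "\<exists>d e c. cyclic_coordinates G (\<lambda>i. p ^ e i) d c \<and> (\<forall>i<d. 0 < e i) \<and>
    (\<forall>j<d. \<forall>i<j. e j \<le> e i)"
proof -
  have p1: "1 < p"
    using prime prime_gt_1_nat by blast
  show ?thesis
  proof (cases "carrier G = {\<one>}")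
    case True
    have "cyclic_coordinates G (\<lambda>i. p ^ 0) 0 (\<lambda>_ _. 0)"
      by unfold_locales (auto simp: True)
    then show ?thesis
      by (intro exI[of _ 0] exI[of _ "\<lambda>_. 0"] exI[of _ "\<lambda>_ _. 0"]) simp
  next
    case nontrivial: False
    define e where "e = (LEAST e. \<forall>y\<in>carrier G. y [^] (p ^ e) = \<one>)"
    have "\<forall>y\<in>carrier G. y [^] (p ^ n) = \<one>"
      using fin order pow_order_eq_1 by metis
    then have exponent: "y [^] (p ^ e) = \<one>" if "y \<in> carrier G" for y
      using LeastI[of "\<lambda>e. \<forall>y\<in>carrier G. y [^] (p ^ e) = \<one>" n] that by (simp add: e_def)
    have "e \<noteq> 0"
      using exponent nontrivial by (auto intro: ccontr)
    then obtain x where x: "x \<in> carrier G" "x [^] (p ^ (e - 1)) \<noteq> \<one>"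
      using not_less_Least[of "e - 1" "\<lambda>e. \<forall>y\<in>carrier G. y [^] (p ^ e) = \<one>"]
      by (auto simp: e_def)
    have "ord x dvd p ^ e" "\<not> ord x dvd p ^ (e - 1)"
      using x exponent pow_eq_id by blast+
    then obtain i where i: "i \<le> e" "ord x = p ^ i" "\<not> i \<le> e - 1"
      using divides_primepow_nat[OF prime] by auto
    then have ord: "ord x = p ^ e"
      by (metis One_nat_def Suc_pred \<open>e \<noteq> 0\<close> le_SucE neq0_conv)
    obtain H where H: "subgroup H G"
      and Hx: "\<And>k::int. x [^] k \<in> H \<Longrightarrow> x [^] k = \<one>"
      and span: "\<And>g. g \<in> carrier G \<Longrightarrow> \<exists>(k::int) h. h \<in> H \<and> g = x [^] k \<otimes> h"
      using cyclic_complement[OF fin prime x(1) ord exponent] by blast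
    interpret H: subgroup H G by fact
    let ?H = "G\<lparr>carrier := H\<rparr>"
    have uniq: "h = h' \<and> k mod int (p ^ e) = l mod int (p ^ e)"
      if eq: "x [^] (k::int) \<otimes> h = x [^] l \<otimes> h'" and h: "h \<in> H" "h' \<in> H" for k l h h'
    proof -
      have "x [^] (k - l) = x [^] k \<otimes> h \<otimes> inv h \<otimes> inv (x [^] l)"
        using x h by (simp add: m_assoc int_pow_diff)
      also have "\<dots> = x [^] l \<otimes> inv (x [^] l) \<otimes> (h' \<otimes> inv h)"
        using x h unfolding eq by (simp add: m_ac del: r_inv r_inv_ex)
      also have "\<dots> = h' \<otimes> inv h"
        using x h by simp
      finally have kl: "x [^] (k - l) = h' \<otimes> inv h" .
      then have one: "x [^] (k - l) = \<one>"
        using h by (intro Hx) simp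
      then have "h' \<otimes> inv h = \<one>"
        using kl by simp
      then have "h = h'"
        using h by (metis H.mem_carrier inv_closed inv_equality inv_inv)
      moreover have "int (p ^ e) dvd k - l"
        using one x(1) ord int_pow_eq_id by metis
      ultimately show ?thesis
        by (simp add: mod_eq_dvd_iff)
    qed
    have "card (rcosets H) * card H = p ^ n"
      using lagrange[OF H] order by simp
    then have "card H dvd p ^ n"
      by (metis dvd_triv_right)
    then obtain m where m: "m \<le> n" "card H = p ^ m"
      using divides_primepow_nat[OF prime] by blast
    have "x \<notin> H"
    proof
      assume "x \<in> H"
      then have "x = \<one>"
        using Hx[of 1] x by simp
      then show False
        using x by simp
    qed
    then have "card H < card (carrier G)"
      using x(1) H.subset fin by (intro psubset_card_mono) auto
    then have "p ^ m < p ^ n"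
      using m order by (simp add: order_def)
    then have "m < n"
      using p1 by simp
    from IH[OF H \<open>m < n\<close> m(2)]
    obtain d e' c where coords: "cyclic_coordinates ?H (\<lambda>i. p ^ e' i) d c"
      and e': "\<forall>i<d. 0 < e' i" "\<forall>j<d. \<forall>i<j. e' j \<le> e' i"
      by blast
    interpret c: cyclic_coordinates ?H "\<lambda>i. p ^ e' i" d c by fact
    \<comment> \<open>A unit vector of the complement has order divisible by p^(e' j), yet p^e kills
      it. This keeps the exponents sorted after prepending e.\<close>
    have e'_le: "e' j \<le> e" if "j < d" for j
    proof -
      have "1 < p ^ e' i" if "i < d" for i
        using e'(1) p1 that by (intro one_less_power) auto
      then obtain h where h: "h \<in> H" "\<forall>i<d. c h i = (if i = j then 1 else 0)"
        using c.ex_unit_vector[of j] by auto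
      have "h [^]\<^bsub>?H\<^esub> (p ^ e) = \<one>"
        using h exponent by (simp flip: nat_pow_consistent)
      then have "c (h [^]\<^bsub>?H\<^esub> (p ^ e)) j = 0"
        using c.coord_one that by simp
      then have "int (p ^ e' j) dvd int (p ^ e)"
        using c.coord_pow[of h j "p ^ e"] h that by (simp add: dvd_eq_mod_eq_0)
      then show ?thesis
        using p1 by (meson int_dvd_int_iff power_dvd_imp_le)
    qed
    obtain K h where hH: "\<And>g. g \<in> carrier G \<Longrightarrow> h g \<in> H"
      and dec: "\<And>g. g \<in> carrier G \<Longrightarrow> g = x [^] (K g :: int) \<otimes> h g"
      using span by metis
    define c' where "c' g i = (case i of 0 \<Rightarrow> K g mod int (p ^ e) | Suc j \<Rightarrow> c (h g) j)" for g i
    define e'' where "e'' = case_nat e e'"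
    \<comment> \<open>K and h are arbitrary choices. Any other decomposition of g agrees with the
      chosen one up to multiples of p^e in the exponent, which makes h, and K modulo p^e,
      homomorphisms.\<close>
    have decI: "h g = h' \<and> K g mod int (p ^ e) = k mod int (p ^ e)"
      if "g = x [^] k \<otimes> h'" "h' \<in> H" for g k h'
      using hH[of g] dec[of g] uniq[of "K g" "h g" k h'] that x H.mem_carrier by (metis int_pow_closed m_closed)
    have "cyclic_coordinates G (\<lambda>i. p ^ e'' i) (Suc d) c'"
    proof unfold_locales
      show "0 < p ^ e'' i" for i
        using p1 by simp
    next
      fix g g' i assume g: "g \<in> carrier G" "g' \<in> carrier G" "i < Suc d"
      have "g \<otimes> g' = (x [^] K g \<otimes> h g) \<otimes> (x [^] K g' \<otimes> h g')"
        using dec[OF g(1)] dec[OF g(2)] by metis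
      also have "\<dots> = x [^] (K g + K g') \<otimes> (h g \<otimes> h g')"
        using hH[OF g(1)] hH[OF g(2)] x by (simp add: int_pow_mult m_ac)
      finally have "h (g \<otimes> g') = h g \<otimes> h g' \<and> K (g \<otimes> g') mod int (p ^ e) = (K g + K g') mod int (p ^ e)"
        using hH[OF g(1)] hH[OF g(2)] by (intro decI) auto
      then show "c' (g \<otimes> g') i = (c' g i + c' g' i) mod int (p ^ e'' i)"
        using g(3) hH[OF g(1)] hH[OF g(2)] c.coord_mult[of "h g" "h g'"]
        by (auto simp: c'_def e''_def mod_simps split: nat.splits)
    next
      fix g g' assume g: "g \<in> carrier G" "g' \<in> carrier G"
        and eq: "\<And>i. i < Suc d \<Longrightarrow> c' g i = c' g' i"
      have "h g = h g'"
        using hH g eq[of "Suc _"] by (intro c.coord_inject) (auto simp: c'_def)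
      moreover have "x [^] K g = x [^] K g'"
        using eq[of 0] x(1) ord by (simp add: c'_def int_pow_eq mod_eq_dvd_iff dvd_diff_commute)
      ultimately show "g = g'"
        using dec[OF g(1)] dec[OF g(2)] by metis
    next
      fix f :: "nat \<Rightarrow> int"
      obtain h' where h': "h' \<in> H" "\<forall>i<d. c h' i = f (Suc i) mod int (p ^ e' i)"
        using c.coord_surj[of "\<lambda>i. f (Suc i)"] by auto
      have "x [^] f 0 \<otimes> h' \<in> carrier G"
        using x(1) h'(1) by simp
      moreover have "\<forall>i<Suc d. c' (x [^] f 0 \<otimes> h') i = f i mod int (p ^ e'' i)"
        using decI[OF refl h'(1), of "f 0"] h' by (auto simp: c'_def e''_def split: nat.splits)
      ultimately show "\<exists>g\<in>carrier G. \<forall>i<Suc d. c' g i = f i mod int (p ^ e'' i)"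
        by blast
    qed
    moreover have "\<forall>i<Suc d. 0 < e'' i" "\<forall>j<Suc d. \<forall>i<j. e'' j \<le> e'' i"
      using e' e'_le \<open>e \<noteq> 0\<close> by (auto simp: e''_def split: nat.splits)
    ultimately show ?thesis
      by blast
  qed
qed

lemma ex_prime_power_coordinates:
  assumes "comm_group G" "finite (carrier G)" "Factorial_Ring.prime p" "order G = p ^ n"
  shows "\<exists>d e c. cyclic_coordinates G (\<lambda>i. p ^ e i) d c \<and> (\<forall>i<d. 0 < e i) \<and>
    (\<forall>j<d. \<forall>i<j. e j \<le> e i)"
  using assms
proof (induction n arbitrary: G rule: less_induct)
  case (less n)
  show ?case
  proof (rule comm_group.ex_prime_power_coordinates_step[OF less.prems])
    fix H m assume H: "subgroup H G" and m: "m < n" "card H = p ^ m"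
    have "finite H"
      using H less.prems(2) by (meson finite_subset subgroup.subset)
    then show "\<exists>d e c. cyclic_coordinates (G\<lparr>carrier := H\<rparr>) (\<lambda>i. p ^ e i) d c \<and> (\<forall>i<d. 0 < e i) \<and>
        (\<forall>j<d. \<forall>i<j. e j \<le> e i)"
      using m(2) less.prems(3) comm_group.subgroup_comm_group[OF less.prems(1) H]
      by (intro less.IH[OF m(1)]) (simp_all add: order_def)
  qed
qed

text \<open>If z^p is outside H, then z^p and H generate G, so z = z^(pk) h and z^(1 - pk) lies in
  H. Since 1 - pk is coprime to the order p^n, Bezout puts z itself into H. The index of H never has
  to be computed.\<close>

lemma (in comm_group) pow_prime_in_maximal_subgroup:
  assumes "Factorial_Ring.prime p" "order G = p ^ n" "finite (carrier G)"
    and max: "maximal_subgroup H G" and z: "z \<in> carrier G"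
  shows "z [^] p \<in> H"
proof (rule ccontr)
  assume not_in: "z [^] p \<notin> H"
  have H: "subgroup H G"
    using max by (simp add: maximal_subgroup_def)
  interpret H: subgroup H G by fact
  define K where "K = {(z [^] p) [^] k \<otimes> h | (k::int) h. h \<in> H}"
  have "subgroup K G"
    unfolding K_def by (rule subgroup_cyclic_set_mult[OF H]) (simp add: z)
  moreover have "H \<subseteq> K"
  proof
    fix h assume "h \<in> H"
    then have "h = (z [^] p) [^] (0::int) \<otimes> h" by simp
    with \<open>h \<in> H\<close> show "h \<in> K" unfolding K_def by blast
  qed
  moreover have "z [^] p \<in> K"
  proof -
    have "z [^] p = (z [^] p) [^] (1::int) \<otimes> \<one>" using z by simp
    then show ?thesis unfolding K_def using H.one_closed by blast
  qed
  ultimately have "K = carrier G"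
    using max not_in unfolding maximal_subgroup_def by blast
  then obtain k h where kh: "z = (z [^] p) [^] (k::int) \<otimes> h" "h \<in> H"
    using z unfolding K_def by blast
  have zp: "(z [^] p) [^] k = z [^] (int p * k)"
    using z by (metis int_pow_int int_pow_pow)
  have "z [^] (1 - int p * k) = z \<otimes> inv (z [^] (int p * k))"
    using z by (simp add: int_pow_diff)
  also have "\<dots> = h"
    using kh(1) z H.mem_carrier[OF kh(2)] unfolding zp
    by (metis int_pow_closed inv_solve_right m_comm)
  finally have zh: "z [^] (1 - int p * k) = h" .
  have "coprime (int p) (1 - int p * k)"
  proof (rule coprimeI)
    fix c assume "c dvd int p" "c dvd 1 - int p * k"
    then have "c dvd 1 - int p * k + int p * k"
      by (intro dvd_add dvd_mult2)
    then show "is_unit c" by simp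
  qed
  then have "coprime (int (p ^ n)) (1 - int p * k)"
    by simp
  then obtain u v where uv: "u * int (p ^ n) + v * (1 - int p * k) = 1"
    using bezout_int[of "int (p ^ n)" "1 - int p * k"] by (auto simp: coprime_iff_gcd_eq_1)
  have "z = z [^] (u * int (p ^ n) + v * (1 - int p * k))"
    using uv z by simp
  also have "\<dots> = z [^] (int (p ^ n) * u) \<otimes> z [^] ((1 - int p * k) * v)"
    using z by (simp only: int_pow_mult mult.commute)
  also have "\<dots> = (z [^] (p ^ n)) [^] u \<otimes> h [^] v"
    using z by (metis int_pow_int int_pow_pow zh)
  also have "\<dots> = h [^] v"
    using pow_order_eq_1[OF z] assms(2) kh(2) H.mem_carrier by simp
  finally have "z \<in> H"
    using subgroup_int_pow_closed[OF H kh(2)] by simp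
  then have "z [^] p \<in> H"
    using subgroup_int_pow_closed[OF H, of z "int p"] by (simp add: int_pow_int)
  with not_in show False ..
qed

section \<open>Order, Frattini subgroup, exponent and multiplier bound from the type\<close>

locale prime_power_coordinates = cyclic_coordinates G "\<lambda>i. p ^ e i" d c
  for G (structure) and p :: nat and e d c +
  assumes prime: "Factorial_Ring.prime p" and exponent_pos: "i < d \<Longrightarrow> 0 < e i"
begin

lemma prime_power_gt_1: "i < d \<Longrightarrow> 1 < p ^ e i"
  using prime_gt_1_nat[OF prime] exponent_pos by (intro one_less_power) auto

lemma order_prime_power: "order G = p ^ (\<Sum>i<d. e i)"
  by (simp add: order_eq power_sum)

lemma finite_carrier: "finite (carrier G)"
  using order_prime_power prime_gt_0_nat[OF prime] by (metis card.infinite neq0_conv order_def power_eq_0_iff)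

lemma prime_dvd_mod: "i < d \<Longrightarrow> int p dvd a mod int (p ^ e i) \<longleftrightarrow> int p dvd a"
  using exponent_pos[of i] by (intro dvd_mod_iff) (simp add: dvd_power)

text \<open>This is the kernel of coordinate i modulo p. For a larger K, some z in K has coordinate
  i invertible modulo p, and every y is then a power of z times an element of the kernel.\<close>

lemma maximal_subgroup_coord:
  assumes "i < d" shows "maximal_subgroup {x \<in> carrier G. int p dvd c x i} G"
proof -
  let ?H = "{x \<in> carrier G. int p dvd c x i}"
  have dvd_mult: "int p dvd c (x \<otimes> y) i \<longleftrightarrow> int p dvd c x i + c y i"
    if "x \<in> carrier G" "y \<in> carrier G" for x y
    using that assms by (simp only: coord_mult prime_dvd_mod)
  have dvd_inv: "int p dvd c (inv x) i \<longleftrightarrow> int p dvd c x i" if "x \<in> carrier G" for x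
    using that assms by (simp only: coord_inv prime_dvd_mod dvd_minus_iff)
  have dvd_pow: "int p dvd c (x [^] (k::nat)) i - int k * c x i" if "x \<in> carrier G" for x k
  proof -
    have "int p dvd (c (x [^] k) i - int k * c x i) mod int (p ^ e i)"
      using that assms coord_pow[OF that assms, of k] by (simp add: mod_diff_left_eq)
    then show ?thesis
      by (simp only: prime_dvd_mod[OF assms])
  qed
  have sub: "subgroup ?H G"
  proof (rule subgroupI)
    show "?H \<noteq> {}"
      using coord_one[OF assms] by auto
  qed (auto simp: dvd_mult dvd_inv)
  obtain x where x: "x \<in> carrier G" "c x i = 1"
    using ex_unit_vector[OF prime_power_gt_1, of i] assms by auto
  moreover have "\<not> int p dvd 1"
    using prime_gt_1_nat[OF prime] by simp
  ultimately have proper: "?H \<noteq> carrier G"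
    by (metis (no_types, lifting) mem_Collect_eq)
  have "K = carrier G" if K: "subgroup K G" "?H \<subseteq> K" "K \<noteq> ?H" for K
  proof -
    interpret K: subgroup K G by fact
    obtain z where z: "z \<in> K" "z \<in> carrier G" "\<not> int p dvd c z i"
      using K K.subset by blast
    have "y \<in> K" if y: "y \<in> carrier G" for y
    proof -
      have "coprime (int p) (c z i)"
        using z prime by (simp add: prime_imp_coprime)
      then obtain u v where uv: "u * int p + v * c z i = 1"
        using bezout_int[of "int p" "c z i"] by (auto simp: coprime_iff_gcd_eq_1)
      \<comment> \<open>v inverts \<open>c z i\<close> modulo p, so z^k and y have the same
        coordinate i modulo p. Reduction modulo p makes k a natural number, as
        \<open>dvd_pow\<close> requires.\<close>
      define k where "k = nat (v * c y i mod int p)"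
      have k: "int k = v * c y i mod int p"
        using prime_gt_0_nat[OF prime] by (simp add: k_def)
      have "int p dvd v * c y i - int k"
        by (simp add: k minus_mod_eq_mult_div)
      then have 1: "int p dvd (v * c y i - int k) * c z i"
        by simp
      have "1 - v * c z i = u * int p"
        using uv by simp
      then have 2: "int p dvd c y i * (1 - v * c z i)"
        by simp
      have "int p dvd c y i * (1 - v * c z i) + (v * c y i - int k) * c z i
          - (c (z [^] k) i - int k * c z i)"
        using dvd_add[OF 2 1] dvd_pow[OF z(2), of k] by (rule dvd_diff)
      then have 3: "int p dvd c y i - c (z [^] k) i"
        by (simp add: algebra_simps)
      have 4: "int p dvd c (inv (z [^] k)) i + c (z [^] k) i"
        using dvd_mult[of "inv (z [^] k)" "z [^] k"] z coord_one[OF assms] by simp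
      have "int p dvd c y i + c (inv (z [^] k)) i"
        using dvd_add[OF 3 4] by simp
      then have "y \<otimes> inv (z [^] k) \<in> ?H"
        using y z by (simp add: dvd_mult)
      then have "y \<otimes> inv (z [^] k) \<in> K"
        using K(2) by blast
      moreover have "z [^] k \<in> K"
        using subgroup_int_pow_closed[OF K(1) z(1), of "int k"] by (simp add: int_pow_int)
      ultimately have "y \<otimes> inv (z [^] k) \<otimes> z [^] k \<in> K"
        by blast
      then show ?thesis
        using y z by (simp add: m_assoc)
    qed
    then show ?thesis
      using K.subset by blast
  qed
  then show ?thesis
    using sub proper by (auto simp: maximal_subgroup_def)
qed

text \<open>One inclusion uses the maximal subgroups cut out by single coordinates. For the other,
  dividing all coordinates by p exhibits x as a p-th power, and p-th powers lie in every maximal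
  subgroup.\<close>

lemma frattini_eq: "frattini G = {x \<in> carrier G. \<forall>i<d. int p dvd c x i}"
proof (intro equalityI subsetI)
  fix x assume "x \<in> frattini G"
  then show "x \<in> {x \<in> carrier G. \<forall>i<d. int p dvd c x i}"
    using maximal_subgroup_coord unfolding frattini_def by blast
next
  fix x assume x: "x \<in> {x \<in> carrier G. \<forall>i<d. int p dvd c x i}"
  obtain y where y: "y \<in> carrier G" "\<forall>i<d. c y i = c x i div int p mod int (p ^ e i)"
    using coord_surj[of "\<lambda>i. c x i div int p"] by blast
  have "c (y [^] p) i = c x i" if "i < d" for i
  proof -
    have "c (y [^] p) i = int p * (c x i div int p) mod int (p ^ e i)"
      using y that coord_pow[of y i p] by (simp add: mod_mult_right_eq)
    also have "\<dots> = c x i"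
      using x that coord_mod[of x i] by simp
    finally show ?thesis .
  qed
  then have "y [^] p = x"
    using x y by (intro coord_inject) auto
  then show "x \<in> frattini G"
    using x y pow_prime_in_maximal_subgroup[OF prime order_prime_power finite_carrier _ y(1)]
    by (auto simp: frattini_def)
qed

lemma card_frattini: "card (frattini G) = p ^ (\<Sum>i<d. e i - 1)"
proof -
  define A where "A i = {v \<in> {0..<int (p ^ e i)}. int p dvd v}" for i
  have card_A: "card (A i) = p ^ (e i - 1)" if "i < d" for i
  proof -
    obtain k where k: "e i = Suc k"
      using exponent_pos[OF \<open>i < d\<close>] gr0_implies_Suc by blast
    have p: "0 < int p"
      using prime_gt_0_nat[OF prime] by simp
    have "A i = (\<lambda>v. int p * v) ` {0..<int (p ^ k)}"
      using p by (auto simp: A_def k zero_le_mult_iff)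
    moreover have "inj_on (\<lambda>v. int p * v) {0..<int (p ^ k)}"
      using p by (auto intro: inj_onI)
    ultimately show ?thesis
      by (simp add: card_image k nat_power_eq)
  qed
  have "frattini G = {x \<in> carrier G. \<forall>i<d. c x i \<in> A i}"
    using coord_range by (auto simp: frattini_eq A_def)
  also have "card \<dots> = (\<Prod>i<d. card (A i))"
    by (rule card_coord_set) (auto simp: A_def)
  also have "\<dots> = p ^ (\<Sum>i<d. e i - 1)"
    by (simp add: card_A power_sum)
  finally show ?thesis .
qed

lemma group_exponent_eq:
  assumes "0 < d" "\<And>j. j < d \<Longrightarrow> e j \<le> e 0"
  shows "group_exponent G = p ^ e 0"
proof (rule dvd_antisym)
  have "x [^] (p ^ e 0) = \<one>" if "x \<in> carrier G" for x
  proof -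
    have "c (x [^] (p ^ e 0)) i = 0" if "i < d" for i
    proof -
      have "int (p ^ e i) dvd int (p ^ e 0)"
        using assms(2)[OF that] by (simp add: le_imp_power_dvd)
      then show ?thesis
        using coord_pow[OF \<open>x \<in> carrier G\<close> that, of "p ^ e 0"] by (metis dvd_mult2 dvd_imp_mod_0)
    qed
    then show ?thesis
      using that coord_eq_one_iff by simp
  qed
  then show "group_exponent G dvd p ^ e 0"
    unfolding group_exponent_def by (intro Lcm_least) (auto simp: pow_eq_id)
  obtain x where x: "x \<in> carrier G" "c x 0 = 1"
    using ex_unit_vector[OF prime_power_gt_1, of 0] assms(1) by auto
  have "int (ord x) * c x 0 mod int (p ^ e 0) = 0"
    using coord_pow[OF x(1) assms(1), of "ord x"] coord_one[OF assms(1)] x(1) by simp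
  then have "int (p ^ e 0) dvd int (ord x)"
    using x(2) by (simp add: dvd_eq_mod_eq_0)
  then have "p ^ e 0 dvd ord x"
    by (simp only: int_dvd_int_iff)
  also have "ord x dvd group_exponent G"
    unfolding group_exponent_def using x(1) by (intro dvd_Lcm) simp
  finally show "p ^ e 0 dvd group_exponent G" .
qed

text \<open>For sorted exponents the gcd is the factor with the larger index, and j is the larger
  index in exactly j pairs.\<close>

lemma schur_multiplier_ge_prime_power:
  assumes "order (schur_multiplier G) \<noteq> 0" "\<And>i j. i < j \<Longrightarrow> j < d \<Longrightarrow> e j \<le> e i"
  shows "p ^ (\<Sum>j<d. j * e j) \<le> order (schur_multiplier G)"
proof -
  have "gcd (p ^ e i) (p ^ e j) = p ^ e j" if "i < j" "j < d" for i j
    using assms(2)[OF that] by (simp add: gcd_nat.absorb2 le_imp_power_dvd)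
  then have "(\<Prod>j<d. \<Prod>i<j. gcd (p ^ e i) (p ^ e j)) = (\<Prod>j<d. \<Prod>i<j. p ^ e j)"
    by (intro prod.cong refl) simp
  also have "\<dots> = p ^ (\<Sum>j<d. j * e j)"
    by (simp add: power_sum mult.commute flip: power_mult)
  finally show ?thesis
    using schur_multiplier_ge[OF prime_power_gt_1 assms(1)] by simp
qed

end

section \<open>From the type to the isomorphism\<close>

lemma (in cyclic_coordinates) iso_product:
  assumes "d = Suc (Suc k)" "\<And>i. i < k \<Longrightarrow> q (Suc (Suc i)) = r"
  shows "G \<cong> integer_mod_group (q 0) \<times>\<times>
    (integer_mod_group (q 1) \<times>\<times> product_group {..<k} (\<lambda>_. integer_mod_group r))" (is "_ \<cong> ?P")
proof -
  define \<phi> where "\<phi> x = (c x 0, c x 1, \<lambda>i\<in>{..<k}. c x (Suc (Suc i)))" for x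
  have q: "0 < q 0" "0 < q 1" "i < k \<Longrightarrow> 0 < r" for i
    using modulus_pos[of 0] modulus_pos[of 1] modulus_pos[of "Suc (Suc i)"] assms by auto
  \<comment> \<open>For k = 0 nothing is known about r, which may be 0, but the product over the
    empty index set is the same for every r.\<close>
  have carrier_P: "carrier ?P = {0..<int (q 0)} \<times> {0..<int (q 1)} \<times> ({..<k} \<rightarrow>\<^sub>E {0..<int r})"
    using q by (cases "k = 0") (auto simp: carrier_integer_mod_group)
  have "\<phi> \<in> carrier G \<rightarrow> carrier ?P"
    unfolding carrier_P
    using coord_range assms by (fastforce simp: \<phi>_def PiE_iff)
  note closed = this
  have "\<phi> (x \<otimes> y) = \<phi> x \<otimes>\<^bsub>?P\<^esub> \<phi> y" if "x \<in> carrier G" "y \<in> carrier G" for x y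
    using that assms by (auto simp: \<phi>_def coord_mult restrict_def fun_eq_iff)
  with closed have "\<phi> \<in> hom G ?P"
    unfolding hom_def by blast
  moreover have "inj_on \<phi> (carrier G)"
  proof (rule inj_onI)
    fix x y assume x: "x \<in> carrier G" and y: "y \<in> carrier G" and eq: "\<phi> x = \<phi> y"
    have 0: "c x 0 = c y 0" and 1: "c x 1 = c y 1"
      and f: "(\<lambda>i\<in>{..<k}. c x (Suc (Suc i))) = (\<lambda>i\<in>{..<k}. c y (Suc (Suc i)))"
      using eq by (simp_all add: \<phi>_def)
    have 2: "c x (Suc (Suc i)) = c y (Suc (Suc i))" if "i < k" for i
      using fun_cong[OF f, of i] that by simp
    show "x = y"
    proof (rule coord_inject[OF x y])
      fix i assume "i < d"
      then show "c x i = c y i"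
        using 0 1 2 assms(1) by (cases i; cases "i - 1") auto
    qed
  qed
  moreover have "carrier ?P \<subseteq> \<phi> ` carrier G"
  proof
    fix w assume "w \<in> carrier ?P"
    then obtain u v f where w: "w = (u, v, f)" "u \<in> {0..<int (q 0)}" "v \<in> {0..<int (q 1)}"
      "f \<in> {..<k} \<rightarrow>\<^sub>E {0..<int r}"
      unfolding carrier_P by blast
    obtain x where x: "x \<in> carrier G"
      "\<forall>i<d. c x i = (case i of 0 \<Rightarrow> u | Suc 0 \<Rightarrow> v | Suc (Suc j) \<Rightarrow> f j) mod int (q i)"
      using coord_surj[of "\<lambda>i. case i of 0 \<Rightarrow> u | Suc 0 \<Rightarrow> v | Suc (Suc j) \<Rightarrow> f j"] by blast
    have "c x 0 = u" "c x 1 = v"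
      using x(2) w assms(1) by auto
    moreover have "c x (Suc (Suc i)) = f i" if "i < k" for i
      using x(2) PiE_mem[OF w(4), of i] assms that by auto
    then have "(\<lambda>i\<in>{..<k}. c x (Suc (Suc i))) = f"
      using w(4) by (auto simp: fun_eq_iff PiE_iff extensional_def)
    ultimately have "\<phi> x = w"
      by (simp add: \<phi>_def w(1))
    then show "w \<in> \<phi> ` carrier G"
      using x(1) by blast
  qed
  with closed have "\<phi> ` carrier G = carrier ?P"
    by (intro equalityI funcset_image)
  ultimately have "\<phi> \<in> iso G ?P"
    by (intro isoI) (simp_all only: bij_betw_def simp_thms)
  then show ?thesis
    by (rule is_isoI)
qed

text \<open>Since n = a + d, the difference n(n-1)/2 - d(d-1)/2 equals an - a(a+1)/2. This is the
  origin of m: removing the part d(d-1)/2 of the sum of j e_j turns the bound on the multiplier into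
  a bound by m on the sum S of j f_j.\<close>

lemma prime_power_type_arith:
  fixes e :: "nat \<Rightarrow> nat" and t :: int
  defines "m \<equiv> \<lambda>(a::nat) (n::nat). int a * int n - int a * (int a + 1) div 2 - t"
  assumes pos: "\<And>i. i < d \<Longrightarrow> 0 < e i" and n: "n = (\<Sum>i<d. e i)" and a: "a = (\<Sum>i<d. e i - 1)"
    and "a + 2 \<le> n"
    and schur: "int (\<Sum>j<d. j * e j) \<le> int (n * (n - 1) div 2) - t"
    and e0: "int (e 0) = int a - m a n + 1"
  shows "d = Suc (Suc (n - a - 2)) \<and> int (e 1) = m a n + 1 \<and> (\<forall>i<n - a - 2. e (Suc (Suc i)) = 1)"
proof -
  define f where "f i = e i - 1" for i
  have e: "e i = f i + 1" if "i < d" for i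
    using pos[OF that] by (simp add: f_def)
  have n': "n = a + d"
    using e by (simp add: n a f_def[symmetric] sum_Suc)
  define k where "k = n - a - 2"
  have d: "d = Suc (Suc k)"
    using n' \<open>a + 2 \<le> n\<close> by (simp add: k_def)
  define S where "S = int (\<Sum>j<d. j * f j)"
  define B where "B = int a * (int a + 1) div 2"
  define N where "N = int (n * (n - 1) div 2)"
  have "(\<Sum>j<d. j * e j) = (\<Sum>j<d. j * f j) + (\<Sum>j<d. j)"
    using e by (simp add: algebra_simps sum.distrib)
  then have schur': "S + int (\<Sum>j<d. j) \<le> N - t"
    using schur by (simp add: S_def N_def)
  have sum_d: "2 * int (\<Sum>j<d. j) = int d * (int d - 1)"
    by (induction d) (auto simp: algebra_simps)
  have "2 * (n * (n - 1) div 2) = n * (n - 1)"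
    by (cases n) auto
  then have "2 * N = int (n * (n - 1))"
    unfolding N_def by linarith
  also have "\<dots> = int n * (int n - 1)"
    using \<open>a + 2 \<le> n\<close> by (simp add: of_nat_diff)
  finally have N: "2 * N = (int a + int d) * (int a + int d - 1)"
    by (simp add: n')
  have B: "2 * B = int a * (int a + 1)"
    by (simp add: B_def)
  have "int a * int n = int a * (int a + int d)"
    by (simp add: n')
  then have "m a n = int a * (int a + int d) - B - t"
    unfolding m_def B_def by simp
  moreover have "2 * S \<le> 2 * (int a * (int a + int d) - B - t)"
    using schur' sum_d N B by (simp add: algebra_simps)
  ultimately have m: "int (\<Sum>j<d. j * f j) \<le> m a n"
    by (simp add: S_def)
  have a': "a = f 0 + f 1 + (\<Sum>i<k. f (Suc (Suc i)))"
    by (simp add: a f_def d sum.lessThan_Suc_shift del: sum.lessThan_Suc)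
  \<comment> \<open>The first two summands add up to a - f 0, which is m by \<open>e0\<close>. The
    last one measures the excess over m, so it must vanish, and with it every f j for j \<ge>
    2.\<close>
  have "(\<Sum>j<d. j * f j) = f 1 + (\<Sum>i<k. f (Suc (Suc i))) + (\<Sum>i<k. Suc i * f (Suc (Suc i)))"
    by (simp add: d sum.lessThan_Suc_shift sum.distrib algebra_simps del: sum.lessThan_Suc)
  moreover have "int a = int (f 0) + m a n"
    using e0 e[of 0] d by simp
  ultimately have "(\<Sum>i<k. Suc i * f (Suc (Suc i))) = 0"
    using m a' by linarith
  then have "\<forall>i<k. f (Suc (Suc i)) = 0"
    by simp
  then show ?thesis
    unfolding k_def[symmetric] using a' \<open>int a = int (f 0) + m a n\<close> e d by simp
qed

theorem theorem2p3:
  fixes G :: "('g, 'b) monoid_scheme" and p n a :: nat and t :: int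
  assumes "Factorial_Ring.prime p"
    and "comm_group G"
    and "finite (carrier G)"
    and "order G = p ^ n"
    and "real (order (schur_multiplier G)) = real p powi (int (n * (n - 1) div 2) - t)"
    and "card (frattini G) = p ^ a"
    and "a + 2 \<le> n"
    and "real (group_exponent G) =
           real p powi (int a - (int a * int n - int a * (int a + 1) div 2 - t) + 1)"
  shows "G \<cong> DirProd
            (integer_mod_group (p ^ nat (int a - (int a * int n - int a * (int a + 1) div 2 - t) + 1)))
            (DirProd
              (integer_mod_group (p ^ nat ((int a * int n - int a * (int a + 1) div 2 - t) + 1)))
              (product_group {..<n - a - 2} (\<lambda>_. integer_mod_group p)))"
proof -
  obtain d e c where coords: "cyclic_coordinates G (\<lambda>i. p ^ e i) d c"
    and e: "\<forall>i<d. 0 < e i" "\<forall>j<d. \<forall>i<j. e j \<le> e i"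
    using ex_prime_power_coordinates[OF assms(2,3,1,4)] by blast
  interpret prime_power_coordinates G p e d c
    using coords e(1) assms(1)
    by (simp add: prime_power_coordinates_def prime_power_coordinates_axioms_def)
  have p: "1 < p"
    using prime prime_gt_1_nat by blast
  have n: "n = (\<Sum>i<d. e i)"
    using order_prime_power assms(4) p by simp
  have a: "a = (\<Sum>i<d. e i - 1)"
    using card_frattini assms(6) p by simp
  have "0 < d"
    using n assms(7) by (cases d) auto
  \<comment> \<open>t is any integer, so exponents of unknown sign are compared, through the
    contrapositive of strict monotonicity.\<close>
  have powi_le: "i \<le> j" if "real p powi i \<le> real p powi j" for i j
    using that power_int_strict_increasing[of j i "real p"] p by (cases "i \<le> j") auto
  \<comment> \<open>A power of p is nonzero; this is what yields finiteness of M(G) in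
    \<open>schur_multiplier_ge\<close>.\<close>
  have "real (order (schur_multiplier G)) \<noteq> 0"
    using assms(5) p by simp
  then have "p ^ (\<Sum>j<d. j * e j) \<le> order (schur_multiplier G)"
    using e(2) by (intro schur_multiplier_ge_prime_power) auto
  then have "real p powi int (\<Sum>j<d. j * e j) \<le> real p powi (int (n * (n - 1) div 2) - t)"
    unfolding assms(5)[symmetric] by (simp only: power_int_of_nat of_nat_le_iff flip: of_nat_power)
  then have schur: "int (\<Sum>j<d. j * e j) \<le> int (n * (n - 1) div 2) - t"
    by (rule powi_le)
  have "group_exponent G = p ^ e 0"
    using e(2) \<open>0 < d\<close> by (intro group_exponent_eq) (metis le_refl neq0_conv)+
  then have "real p powi int (e 0) =
      real p powi (int a - (int a * int n - int a * (int a + 1) div 2 - t) + 1)"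
    unfolding assms(8)[symmetric] by simp
  then have e0: "int (e 0) = int a - (int a * int n - int a * (int a + 1) div 2 - t) + 1"
    by (intro order.antisym powi_le) simp_all
  have type: "d = Suc (Suc (n - a - 2))"
    "int (e 1) = int a * int n - int a * (int a + 1) div 2 - t + 1"
    "\<forall>i<n - a - 2. e (Suc (Suc i)) = 1"
    using prime_power_type_arith[OF exponent_pos n a assms(7) schur e0] by auto
  have "G \<cong> integer_mod_group (p ^ e 0) \<times>\<times>
      (integer_mod_group (p ^ e 1) \<times>\<times> product_group {..<n - a - 2} (\<lambda>_. integer_mod_group p))"
    using type(3) by (intro iso_product[OF type(1)]) simp
  \<comment> \<open>Rewriting backwards with \<open>e0\<close> and \<open>type(2)\<close> turns the
    arguments of \<open>nat\<close> into \<open>int (e 0)\<close> and \<open>int (e 1)\<close>, so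
    nothing is truncated.\<close>
  then show ?thesis
    by (simp flip: e0 type(2))
qed

end
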